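(* Let $\Phi$ be a first order $\forall^*\exists^*$ sentence in an algebraic signature such that the class $\mathscr{K}=\operatorname{Mod}_{\rm fin}(\Phi)$ of finite models of $\Phi$ is a uniformly locally finite pseudovariety of finite algebras. Then $\Phi$ is equivalent on finite structures to a finite conjunction of (universally quantified) equations.
   Context: A pseudovariety is a class of finite algebras of the same signature closed under homomorphic images, isomorphic copies of subalgebras and finitary direct products. A class of structures is uniformly locally finite if for every $n$ there exists $m$ such that every $n$-generated substructure of a member of the class has at most $m$ elements. A $\forall^*\exists^*$ sentence is a prenex sentence with a (possibly empty) block of universal quantifiers followed by a (possibly empty) block of existential quantifiers and then a quantifier-free formula. Equivalent on finite structures means having the same finite models. *)

theory Defs
  imports Main "HOL-Library.FuncSet"
begin

section \<open>Algebraic signatures and first-order formulas\<close>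

text \<open>
  A signature is a partial function: its domain is the set of operation symbols, its values are
  the arities. (A total arity function on a type would exclude the empty signature.)
  There are no relation symbols, and no cardinality restriction.
\<close>

type_synonym 'f signature = "'f \<rightharpoonup> nat"

datatype 'f trm = Var nat | Fun 'f "'f trm list"

datatype 'f fm =
    Bot
  | Eq "'f trm" "'f trm"
  | Neg "'f fm"
  | And "'f fm" "'f fm"
  | Or "'f fm" "'f fm"
  | Imp "'f fm" "'f fm"
  | All nat "'f fm"
  | Ex nat "'f fm"

primrec wf_trm :: "'f signature \<Rightarrow> 'f trm \<Rightarrow> bool" where
  "wf_trm sig (Var x) \<longleftrightarrow> True"
| "wf_trm sig (Fun f ts) \<longleftrightarrow> sig f = Some (length ts) \<and> list_all (wf_trm sig) ts"

primrec wf_fm :: "'f signature \<Rightarrow> 'f fm \<Rightarrow> bool" where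
  "wf_fm sig Bot \<longleftrightarrow> True"
| "wf_fm sig (Eq s t) \<longleftrightarrow> wf_trm sig s \<and> wf_trm sig t"
| "wf_fm sig (Neg p) \<longleftrightarrow> wf_fm sig p"
| "wf_fm sig (And p q) \<longleftrightarrow> wf_fm sig p \<and> wf_fm sig q"
| "wf_fm sig (Or p q) \<longleftrightarrow> wf_fm sig p \<and> wf_fm sig q"
| "wf_fm sig (Imp p q) \<longleftrightarrow> wf_fm sig p \<and> wf_fm sig q"
| "wf_fm sig (All x p) \<longleftrightarrow> wf_fm sig p"
| "wf_fm sig (Ex x p) \<longleftrightarrow> wf_fm sig p"

primrec vars_trm :: "'f trm \<Rightarrow> nat set" where
  "vars_trm (Var x) = {x}"
| "vars_trm (Fun f ts) = \<Union> (set (map vars_trm ts))"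

primrec free_vars :: "'f fm \<Rightarrow> nat set" where
  "free_vars Bot = {}"
| "free_vars (Eq s t) = vars_trm s \<union> vars_trm t"
| "free_vars (Neg p) = free_vars p"
| "free_vars (And p q) = free_vars p \<union> free_vars q"
| "free_vars (Or p q) = free_vars p \<union> free_vars q"
| "free_vars (Imp p q) = free_vars p \<union> free_vars q"
| "free_vars (All x p) = free_vars p - {x}"
| "free_vars (Ex x p) = free_vars p - {x}"

definition sentence :: "'f signature \<Rightarrow> 'f fm \<Rightarrow> bool" where
  "sentence sig p \<longleftrightarrow> wf_fm sig p \<and> free_vars p = {}"

primrec quantifier_free :: "'f fm \<Rightarrow> bool" where
  "quantifier_free Bot \<longleftrightarrow> True"
| "quantifier_free (Eq s t) \<longleftrightarrow> True"
| "quantifier_free (Neg p) \<longleftrightarrow> quantifier_free p"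
| "quantifier_free (And p q) \<longleftrightarrow> quantifier_free p \<and> quantifier_free q"
| "quantifier_free (Or p q) \<longleftrightarrow> quantifier_free p \<and> quantifier_free q"
| "quantifier_free (Imp p q) \<longleftrightarrow> quantifier_free p \<and> quantifier_free q"
| "quantifier_free (All x p) \<longleftrightarrow> False"
| "quantifier_free (Ex x p) \<longleftrightarrow> False"

definition forall_exists_sentence :: "'f signature \<Rightarrow> 'f fm \<Rightarrow> bool" where
  "forall_exists_sentence sig p \<longleftrightarrow> sentence sig p \<and>
     (\<exists>xs ys q. p = foldr All xs (foldr Ex ys q) \<and> quantifier_free q)"

definition universal_equation :: "'f signature \<Rightarrow> 'f fm \<Rightarrow> bool" where
  "universal_equation sig p \<longleftrightarrow> sentence sig p \<and> (\<exists>xs s t. p = foldr All xs (Eq s t))"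

definition conjunction :: "'f fm list \<Rightarrow> 'f fm" where
  "conjunction ps = foldr And ps (Neg Bot)"


section \<open>Algebras and satisfaction\<close>

record ('f, 'a) alg =
  carr :: "'a set"
  oper :: "'f \<Rightarrow> 'a list \<Rightarrow> 'a"

text \<open>
  The values of \<open>oper A f\<close> on lists of the wrong length, on lists that leave the carrier, and for
  symbols outside the signature are irrelevant junk. As usual, carriers are nonempty.
\<close>

definition closed_under_ops :: "'f signature \<Rightarrow> ('f, 'a) alg \<Rightarrow> 'a set \<Rightarrow> bool" where
  "closed_under_ops sig A S \<longleftrightarrow>
     (\<forall>f as. sig f = Some (length as) \<and> set as \<subseteq> S \<longrightarrow> oper A f as \<in> S)"

definition is_alg :: "'f signature \<Rightarrow> ('f, 'a) alg \<Rightarrow> bool" where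
  "is_alg sig A \<longleftrightarrow> carr A \<noteq> {} \<and> closed_under_ops sig A (carr A)"

primrec trm_val :: "('f, 'a) alg \<Rightarrow> (nat \<Rightarrow> 'a) \<Rightarrow> 'f trm \<Rightarrow> 'a" where
  "trm_val A e (Var x) = e x"
| "trm_val A e (Fun f ts) = oper A f (map (trm_val A e) ts)"

primrec sat :: "('f, 'a) alg \<Rightarrow> (nat \<Rightarrow> 'a) \<Rightarrow> 'f fm \<Rightarrow> bool" where
  "sat A e Bot \<longleftrightarrow> False"
| "sat A e (Eq s t) \<longleftrightarrow> trm_val A e s = trm_val A e t"
| "sat A e (Neg p) \<longleftrightarrow> \<not> sat A e p"
| "sat A e (And p q) \<longleftrightarrow> sat A e p \<and> sat A e q"
| "sat A e (Or p q) \<longleftrightarrow> sat A e p \<or> sat A e q"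
| "sat A e (Imp p q) \<longleftrightarrow> (sat A e p \<longrightarrow> sat A e q)"
| "sat A e (All x p) \<longleftrightarrow> (\<forall>a\<in>carr A. sat A (e(x := a)) p)"
| "sat A e (Ex x p) \<longleftrightarrow> (\<exists>a\<in>carr A. sat A (e(x := a)) p)"

definition models :: "('f, 'a) alg \<Rightarrow> 'f fm \<Rightarrow> bool" where
  "models A p \<longleftrightarrow> (\<forall>e. range e \<subseteq> carr A \<longrightarrow> sat A e p)"

definition Mod_fin :: "'f signature \<Rightarrow> 'f fm \<Rightarrow> ('f, 'a) alg set" where
  "Mod_fin sig p = {A. is_alg sig A \<and> finite (carr A) \<and> models A p}"

text \<open>
  HOL cannot quantify over all types inside a formula, so the class of all finite algebras is
  represented by the finite algebras whose carrier is a set of natural numbers. Up to isomorphism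
  these are all finite algebras; lemma \<open>equivalent_on_finite_any_type\<close> below shows that
  equivalence on them is equivalence on the finite algebras over every type.
\<close>

definition equivalent_on_finite :: "'f signature \<Rightarrow> 'f fm \<Rightarrow> 'f fm \<Rightarrow> bool" where
  "equivalent_on_finite sig p q \<longleftrightarrow>
     (Mod_fin sig p :: ('f, nat) alg set) = Mod_fin sig q"


section \<open>Pseudovarieties and uniform local finiteness\<close>

definition hom_alg :: "'f signature \<Rightarrow> ('f, 'a) alg \<Rightarrow> ('f, 'b) alg \<Rightarrow> ('a \<Rightarrow> 'b) set" where
  "hom_alg sig A B = {h. h ` carr A \<subseteq> carr B \<and>
     (\<forall>f as. sig f = Some (length as) \<and> set as \<subseteq> carr A \<longrightarrow>
        h (oper A f as) = oper B f (map h as))}"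

definition hom_image :: "'f signature \<Rightarrow> ('f, 'a) alg \<Rightarrow> ('f, 'b) alg \<Rightarrow> bool" where
  "hom_image sig A B \<longleftrightarrow> (\<exists>h\<in>hom_alg sig A B. h ` carr A = carr B)"

definition isomorphic :: "'f signature \<Rightarrow> ('f, 'a) alg \<Rightarrow> ('f, 'b) alg \<Rightarrow> bool" where
  "isomorphic sig A B \<longleftrightarrow> (\<exists>h\<in>hom_alg sig A B. bij_betw h (carr A) (carr B))"

definition subuniverse :: "'f signature \<Rightarrow> ('f, 'a) alg \<Rightarrow> 'a set \<Rightarrow> bool" where
  "subuniverse sig A S \<longleftrightarrow> S \<subseteq> carr A \<and> closed_under_ops sig A S"

definition subalgebra :: "'f signature \<Rightarrow> ('f, 'a) alg \<Rightarrow> ('f, 'a) alg \<Rightarrow> bool" where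
  "subalgebra sig B A \<longleftrightarrow> (\<exists>S. S \<noteq> {} \<and> subuniverse sig A S \<and> B = A\<lparr>carr := S\<rparr>)"

definition direct_product :: "'i set \<Rightarrow> ('i \<Rightarrow> ('f, 'a) alg) \<Rightarrow> ('f, 'i \<Rightarrow> 'a) alg" where
  "direct_product I A =
     \<lparr>carr = (\<Pi>\<^sub>E i\<in>I. carr (A i)),
      oper = (\<lambda>f as. \<lambda>i\<in>I. oper (A i) f (map (\<lambda>a. a i) as))\<rparr>"

text \<open>
  The direct product is only determined up to isomorphism inside the fixed universe of carriers,
  hence \<open>isomorphic\<close> in the last clause. Finitary products include the empty product, so a
  pseudovariety contains the one-element algebras; in particular it is not empty.
\<close>

definition pseudovariety :: "'f signature \<Rightarrow> ('f, nat) alg set \<Rightarrow> bool" where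
  "pseudovariety sig K \<longleftrightarrow>
     (\<forall>A\<in>K. is_alg sig A \<and> finite (carr A)) \<and>
     (\<forall>A\<in>K. \<forall>B. is_alg sig B \<and> hom_image sig A B \<longrightarrow> B \<in> K) \<and>
     (\<forall>A\<in>K. \<forall>S B. subalgebra sig S A \<and> is_alg sig B \<and> isomorphic sig S B \<longrightarrow> B \<in> K) \<and>
     (\<forall>(I :: nat set) A B. finite I \<and> (\<forall>i\<in>I. A i \<in> K) \<and>
        is_alg sig B \<and> isomorphic sig (direct_product I A) B \<longrightarrow> B \<in> K)"

definition generated :: "'f signature \<Rightarrow> ('f, 'a) alg \<Rightarrow> 'a set \<Rightarrow> 'a set" where
  "generated sig A X = \<Inter> {S. subuniverse sig A S \<and> X \<subseteq> S}"

definition uniformly_locally_finite :: "'f signature \<Rightarrow> ('f, 'a) alg set \<Rightarrow> bool" where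
  "uniformly_locally_finite sig K \<longleftrightarrow>
     (\<forall>n. \<exists>m. \<forall>A\<in>K. \<forall>X. X \<subseteq> carr A \<and> finite X \<and> card X \<le> n \<longrightarrow>
        finite (generated sig A X) \<and> card (generated sig A X) \<le> m)"


section \<open>Adequacy of the natural numbers as universe of carriers\<close>

lemma trm_val_in_carr:
  assumes "is_alg sig A" "range e \<subseteq> carr A" "wf_trm sig t"
  shows "trm_val A e t \<in> carr A"
  using assms(3)
proof (induction t)
  case (Fun f ts)
  have "set (map (trm_val A e) ts) \<subseteq> carr A"
    using Fun by (auto simp: list_all_iff)
  then show ?case
    using assms(1) Fun.prems unfolding is_alg_def closed_under_ops_def
    by (metis length_map trm_val.simps(2) wf_trm.simps(2))
qed (use assms in auto)

lemma trm_val_hom: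
  assumes "is_alg sig A" "h \<in> hom_alg sig A B" "range e \<subseteq> carr A" "wf_trm sig t"
  shows "trm_val B (h \<circ> e) t = h (trm_val A e t)"
  using assms(4)
proof (induction t)
  case (Fun f ts)
  have "set (map (trm_val A e) ts) \<subseteq> carr A"
    using Fun.prems trm_val_in_carr[OF assms(1,3)] by (auto simp: list_all_iff)
  moreover have "map (trm_val B (h \<circ> e)) ts = map h (map (trm_val A e) ts)"
    using Fun by (auto simp: list_all_iff comp_def)
  moreover have "sig f = Some (length (map (trm_val A e) ts))"
    using Fun.prems by simp
  ultimately show ?case
    using assms(2) unfolding hom_alg_def by (metis (mono_tags, lifting) mem_Collect_eq trm_val.simps(2))
qed simp

lemma sat_iso:
  assumes "is_alg sig A" "h \<in> hom_alg sig A B" "bij_betw h (carr A) (carr B)"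
    and "range e \<subseteq> carr A" "wf_fm sig p"
  shows "sat B (h \<circ> e) p \<longleftrightarrow> sat A e p"
  using assms(4,5)
proof (induction p arbitrary: e)
  case (Eq s t)
  have "inj_on h (carr A)" using assms(3) by (simp add: bij_betw_def)
  then show ?case
    using Eq trm_val_hom[OF assms(1,2)] trm_val_in_carr[OF assms(1)]
    by (simp add: inj_on_eq_iff[where A = "carr A"] del: comp_apply)
next
  case (All x p)
  have "sat B ((h \<circ> e)(x := h a)) p \<longleftrightarrow> sat A (e(x := a)) p" if "a \<in> carr A" for a
  proof -
    have "h \<circ> e(x := a) = (h \<circ> e)(x := h a)" by auto
    moreover have "range (e(x := a)) \<subseteq> carr A" using All.prems(1) that by auto
    ultimately show ?thesis by (metis All.IH All.prems(2) wf_fm.simps(7))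
  qed
  moreover have "carr B = h ` carr A" using assms(3) by (simp add: bij_betw_def)
  ultimately show ?case by (simp add: comp_def)
next
  case (Ex x p)
  have "sat B ((h \<circ> e)(x := h a)) p \<longleftrightarrow> sat A (e(x := a)) p" if "a \<in> carr A" for a
  proof -
    have "h \<circ> e(x := a) = (h \<circ> e)(x := h a)" by auto
    moreover have "range (e(x := a)) \<subseteq> carr A" using Ex.prems(1) that by auto
    ultimately show ?thesis by (metis Ex.IH Ex.prems(2) wf_fm.simps(8))
  qed
  moreover have "carr B = h ` carr A" using assms(3) by (simp add: bij_betw_def)
  ultimately show ?case by (simp add: comp_def)
qed auto

lemma models_iso:
  assumes A: "is_alg sig A" and iso: "isomorphic sig A B" and "wf_fm sig p"
  shows "models B p \<longleftrightarrow> models A p"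
proof -
  obtain h where h: "h \<in> hom_alg sig A B" "bij_betw h (carr A) (carr B)"
    using iso by (auto simp: isomorphic_def)
  have "range (h \<circ> e) \<subseteq> carr B" if "range e \<subseteq> carr A" for e :: "nat \<Rightarrow> _"
    using that h(2) by (auto simp: bij_betw_def)
  moreover have "\<exists>e. range e \<subseteq> carr A \<and> d = h \<circ> e" if "range d \<subseteq> carr B" for d :: "nat \<Rightarrow> _"
  proof (intro exI conjI)
    show "range (inv_into (carr A) h \<circ> d) \<subseteq> carr A"
      using that h(2) by (auto simp: bij_betw_def intro!: inv_into_into)
    show "d = h \<circ> (inv_into (carr A) h \<circ> d)"
      using that h(2) by (auto simp: bij_betw_def f_inv_into_f subset_iff)
  qed
  ultimately show ?thesis
    using sat_iso[OF A h] assms(3) unfolding models_def by metis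
qed

lemma isomorphic_nat_copy:
  fixes A :: "('f, 'a) alg"
  assumes "is_alg sig A" "finite (carr A)"
  obtains B :: "('f, nat) alg" where "is_alg sig B" "finite (carr B)" "isomorphic sig A B"
proof -
  obtain h :: "'a \<Rightarrow> nat" where h: "inj_on h (carr A)"
    using assms(2) finite_imp_inj_to_nat_seg by metis
  define g where "g = inv_into (carr A) h"
  define B where "B = \<lparr>carr = h ` carr A, oper = \<lambda>f bs. h (oper A f (map g bs))\<rparr>"
  have g: "g (h a) = a" if "a \<in> carr A" for a
    using h that by (simp add: g_def)
  have gmap: "map (g \<circ> h) as = as" if "set as \<subseteq> carr A" for as
    by (rule map_idI) (use that g in auto)
  have "closed_under_ops sig B (carr B)"
    unfolding closed_under_ops_def
  proof (intro allI impI)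
    fix f bs assume *: "sig f = Some (length bs) \<and> set bs \<subseteq> carr B"
    then have "set (map g bs) \<subseteq> carr A" using g by (auto simp: B_def)
    moreover have "sig f = Some (length (map g bs))" using * by simp
    ultimately have "oper A f (map g bs) \<in> carr A"
      using assms(1) unfolding is_alg_def closed_under_ops_def by blast
    then show "oper B f bs \<in> carr B" by (simp add: B_def)
  qed
  then have "is_alg sig B" using assms(1) by (simp add: is_alg_def B_def)
  moreover have "h \<in> hom_alg sig A B" by (auto simp: hom_alg_def B_def gmap)
  moreover have "bij_betw h (carr A) (carr B)" using h by (simp add: bij_betw_def B_def)
  moreover have "finite (carr B)" using assms(2) by (simp add: B_def)
  ultimately show thesis using that by (auto simp: isomorphic_def)
qed

lemma equivalent_on_finite_any_type:
  fixes A :: "('f, 'a) alg"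
  assumes "equivalent_on_finite sig p q" "wf_fm sig p" "wf_fm sig q"
    and "is_alg sig A" "finite (carr A)"
  shows "models A p \<longleftrightarrow> models A q"
proof -
  obtain B :: "('f, nat) alg" where B: "is_alg sig B" "finite (carr B)" "isomorphic sig A B"
    using isomorphic_nat_copy[OF assms(4,5)] .
  then have "models B p \<longleftrightarrow> models B q"
    using assms(1) by (auto simp: equivalent_on_finite_def Mod_fin_def set_eq_iff)
  then show ?thesis
    using models_iso[OF assms(4) B(3)] assms(2,3) by simp
qed

end

theory Submission
  imports Defs
begin

text \<open>
  Let \<open>V\<close> be the set of universally quantified variables of \<open>\<Phi>\<close>. Among all valuations of \<open>V\<close> in
  members of the class, uniform local finiteness lets us choose one, in \<open>P\<close> say, at which the terms
  over \<open>V\<close> take the greatest number of values. Comparing \<open>P\<close> with its products with other members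
  shows that an equation over \<open>V\<close> that holds at this valuation holds throughout the class, so the
  values form a finite free algebra. Its operation tables, written with one representing term per
  element, are finitely many equations when the signature is finite. In a model \<open>A\<close> of these
  equations every valuation of \<open>V\<close> extends to a homomorphism from the free algebra, whose image
  belongs to the class; the existential witnesses found in that image are also witnesses in \<open>A\<close>.
  A general signature is reduced to the finite set of symbols of \<open>\<Phi>\<close> by interpreting all other
  symbols as constant operations.
\<close>

section \<open>Satisfaction\<close>

lemma trm_val_cong:
  "(\<And>x. x \<in> vars_trm t \<Longrightarrow> d x = e x) \<Longrightarrow> trm_val A d t = trm_val A e t"
proof (induction t)
  case (Fun f ts)
  have "map (trm_val A d) ts = map (trm_val A e) ts"
    using Fun by (intro map_cong) auto
  then show ?case by (simp del: map_eq_conv)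
qed simp

lemma sat_cong:
  "(\<And>x. x \<in> free_vars p \<Longrightarrow> d x = e x) \<Longrightarrow> sat A d p \<longleftrightarrow> sat A e p"
proof (induction p arbitrary: d e)
  case (Eq s t)
  then have "trm_val A d s = trm_val A e s" "trm_val A d t = trm_val A e t"
    by (auto intro: trm_val_cong)
  then show ?case by simp
next
  case (Neg p)
  have "sat A d p = sat A e p" using Neg.prems by (auto intro!: Neg.IH)
  then show ?case by simp
next
  case (And p q)
  have "sat A d p = sat A e p" "sat A d q = sat A e q"
    using And.prems by (auto intro!: And.IH)
  then show ?case by simp
next
  case (Or p q)
  have "sat A d p = sat A e p" "sat A d q = sat A e q"
    using Or.prems by (auto intro!: Or.IH)
  then show ?case by simp
next
  case (Imp p q)
  have "sat A d p = sat A e p" "sat A d q = sat A e q"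
    using Imp.prems by (auto intro!: Imp.IH)
  then show ?case by simp
next
  case (All x p)
  have "sat A (d(x := a)) p = sat A (e(x := a)) p" for a
    using All.prems by (auto intro!: All.IH)
  then show ?case by simp
next
  case (Ex x p)
  have "sat A (d(x := a)) p = sat A (e(x := a)) p" for a
    using Ex.prems by (auto intro!: Ex.IH)
  then show ?case by simp
qed simp

lemma trm_val_carr_update [simp]: "trm_val (A\<lparr>carr := S\<rparr>) e t = trm_val A e t"
proof (induction t)
  case (Fun f ts)
  then have "map (trm_val (A\<lparr>carr := S\<rparr>) e) ts = map (trm_val A e) ts" by simp
  then show ?case by (simp del: map_eq_conv)
qed simp

lemma sat_quantifier_free_carr_update:
  "quantifier_free q \<Longrightarrow> sat (A\<lparr>carr := S\<rparr>) e q \<longleftrightarrow> sat A e q"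
  by (induction q) auto

text \<open>Shrinking the carrier leaves the operations alone, so the quantifier-free matrix has the
  same truth value in both structures, and witnesses from \<open>S\<close> are still available in
  \<open>carr A\<close>.\<close>

lemma sat_foldr_Ex_mono:
  assumes "quantifier_free q" "S \<subseteq> carr A" "sat (A\<lparr>carr := S\<rparr>) e (foldr Ex ys q)"
  shows "sat A e (foldr Ex ys q)"
  using assms(3)
  by (induction ys arbitrary: e) (use assms(1,2) in \<open>auto simp: sat_quantifier_free_carr_update\<close>)

lemma models_All: "models A (All x p) \<longleftrightarrow> models A p"
proof
  assume "models A (All x p)"
  then have "sat A (e(x := e x)) p" if "range e \<subseteq> carr A" for e
    using that unfolding models_def sat.simps by blast
  then show "models A p" by (simp add: models_def)
next
  assume *: "models A p"
  have "range (e(x := a)) \<subseteq> carr A" if "range e \<subseteq> carr A" "a \<in> carr A" for e a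
    using that by auto
  with * show "models A (All x p)" by (simp add: models_def)
qed

text \<open>Since \<open>models\<close> ranges over all valuations, a universal prefix may be
  dropped, leaving only the matrix to evaluate.\<close>

lemma models_foldr_All: "models A (foldr All xs p) \<longleftrightarrow> models A p"
  by (induction xs) (auto simp: models_All)

lemma free_vars_foldr_All: "free_vars (foldr All xs p) = free_vars p - set xs"
  by (induction xs) auto

lemma wf_fm_foldr_All: "wf_fm sig (foldr All xs p) \<longleftrightarrow> wf_fm sig p"
  by (induction xs) auto

lemma models_conjunction: "models A (conjunction ps) \<longleftrightarrow> (\<forall>p\<in>set ps. models A p)"
proof -
  have "sat A e (conjunction ps) \<longleftrightarrow> (\<forall>p\<in>set ps. sat A e p)" for e
    by (induction ps) (auto simp: conjunction_def)
  then show ?thesis by (auto simp: models_def)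
qed

section \<open>Algebras\<close>

lemma is_algD:
  "is_alg sig A \<Longrightarrow> sig f = Some (length as) \<Longrightarrow> set as \<subseteq> carr A \<Longrightarrow> oper A f as \<in> carr A"
  by (simp add: is_alg_def closed_under_ops_def)

lemma isomorphic_refl: "isomorphic sig A A"
  unfolding isomorphic_def by (rule bexI[of _ id]) (auto simp: hom_alg_def)

lemma is_alg_direct_product:
  assumes "\<And>i. i \<in> I \<Longrightarrow> is_alg sig (A i)"
  shows "is_alg sig (direct_product I A)"
proof -
  have "carr (direct_product I A) \<noteq> {}"
    using assms by (auto simp: direct_product_def PiE_eq_empty_iff is_alg_def)
  moreover have "oper (A i) f (map (\<lambda>a. a i) as) \<in> carr (A i)"
    if "sig f = Some (length as)" "set as \<subseteq> (\<Pi>\<^sub>E i\<in>I. carr (A i))" "i \<in> I" for f as i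
    using that by (intro is_algD[OF assms]) auto
  ultimately show ?thesis
    by (auto simp: is_alg_def closed_under_ops_def direct_product_def)
qed

lemma trm_val_direct_product:
  assumes "\<And>x. e x = (\<lambda>i\<in>I. d i x)" and "wf_trm sig t"
  shows "trm_val (direct_product I A) e t = (\<lambda>i\<in>I. trm_val (A i) (d i) t)"
  using assms(2)
proof (induction t)
  case (Fun f ts)
  then have *: "map (trm_val (direct_product I A) e) ts = map (\<lambda>t. \<lambda>i\<in>I. trm_val (A i) (d i) t) ts"
    by (auto simp: list_all_iff)
  have "oper (A i) f (map ((\<lambda>a. a i) \<circ> (\<lambda>t. \<lambda>i\<in>I. trm_val (A i) (d i) t)) ts)
      = oper (A i) f (map (trm_val (A i) (d i)) ts)" if "i \<in> I" for i
    using that by (intro arg_cong[where f = "oper (A i) f"] map_cong) auto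
  then have "(\<lambda>i\<in>I. oper (A i) f (map (\<lambda>a. a i) (map (trm_val (direct_product I A) e) ts)))
      = (\<lambda>i\<in>I. oper (A i) f (map (trm_val (A i) (d i)) ts))"
    by (simp add: * del: map_eq_conv cong: restrict_cong)
  then show ?case by (simp add: direct_product_def)
qed (simp add: assms)

section \<open>Term values\<close>

definition terms_over :: "'f signature \<Rightarrow> nat set \<Rightarrow> 'f trm set" where
  "terms_over sig V = {t. wf_trm sig t \<and> vars_trm t \<subseteq> V}"

text \<open>Describing the generated elements by terms, not as an intersection of subuniverses,
  supplies each of them with a representing term.\<close>

definition term_values :: "'f signature \<Rightarrow> nat set \<Rightarrow> ('f, 'a) alg \<Rightarrow> (nat \<Rightarrow> 'a) \<Rightarrow> 'a set" where
  "term_values sig V A e = trm_val A e ` terms_over sig V"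

lemma Fun_in_terms_over:
  "Fun f ts \<in> terms_over sig V \<longleftrightarrow> sig f = Some (length ts) \<and> set ts \<subseteq> terms_over sig V"
  by (auto simp: terms_over_def list_all_iff)

text \<open>A subuniverse containing the values of the variables contains those of all terms over
  them. Through this inclusion uniform local finiteness bounds the number of term values.\<close>

lemma term_values_subset_generated: "term_values sig V A e \<subseteq> generated sig A (e ` V)"
proof -
  have "trm_val A e t \<in> S"
    if S: "subuniverse sig A S" "e ` V \<subseteq> S" and t: "wf_trm sig t" "vars_trm t \<subseteq> V" for S t
    using t
  proof (induction t)
    case (Fun f ts)
    then have "set (map (trm_val A e) ts) \<subseteq> S"
      by (auto simp: list_all_iff)
    then show ?case
      using S(1) Fun.prems by (simp add: subuniverse_def closed_under_ops_def)
  qed (use S in auto)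
  then show ?thesis
    by (auto simp: term_values_def terms_over_def generated_def)
qed

lemma term_values_closed: "closed_under_ops sig A (term_values sig V A e)"
  unfolding closed_under_ops_def
proof (intro allI impI)
  fix f as assume *: "sig f = Some (length as) \<and> set as \<subseteq> term_values sig V A e"
  then have "as \<in> lists (trm_val A e ` terms_over sig V)"
    by (auto simp: term_values_def)
  then obtain ts where ts: "as = map (trm_val A e) ts" "set ts \<subseteq> terms_over sig V"
    by (auto simp: lists_image)
  then have "Fun f ts \<in> terms_over sig V" using * by (simp add: Fun_in_terms_over)
  then show "oper A f as \<in> term_values sig V A e"
    by (auto simp: term_values_def ts intro!: rev_image_eqI)
qed

lemma term_values_subset_carr:
  "is_alg sig A \<Longrightarrow> range e \<subseteq> carr A \<Longrightarrow> term_values sig V A e \<subseteq> carr A"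
  by (auto simp: term_values_def terms_over_def intro: trm_val_in_carr)

lemma term_values_hom:
  assumes "is_alg sig A" "h \<in> hom_alg sig A B" "range e \<subseteq> carr A"
  shows "term_values sig V B (h \<circ> e) = h ` term_values sig V A e"
proof -
  have "trm_val B (h \<circ> e) t = h (trm_val A e t)" if "t \<in> terms_over sig V" for t
    using trm_val_hom[OF assms] that by (simp add: terms_over_def)
  then show ?thesis by (simp add: term_values_def image_image)
qed

section \<open>Pseudovarieties and free valuations\<close>

lemma pseudovariety_alg:
  "pseudovariety sig K \<Longrightarrow> A \<in> K \<Longrightarrow> is_alg sig A \<and> finite (carr A)"
  unfolding pseudovariety_def by blast

lemma pseudovariety_hom_image:
  "pseudovariety sig K \<Longrightarrow> A \<in> K \<Longrightarrow> is_alg sig B \<Longrightarrow> hom_image sig A B \<Longrightarrow> B \<in> K"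
  unfolding pseudovariety_def by blast

lemma pseudovariety_subalgebra:
  "pseudovariety sig K \<Longrightarrow> A \<in> K \<Longrightarrow> subalgebra sig S A \<Longrightarrow> is_alg sig B \<Longrightarrow> isomorphic sig S B \<Longrightarrow>
    B \<in> K"
  unfolding pseudovariety_def by blast

lemma pseudovariety_direct_product:
  fixes I :: "nat set"
  shows "pseudovariety sig K \<Longrightarrow> finite I \<Longrightarrow> (\<And>i. i \<in> I \<Longrightarrow> A i \<in> K) \<Longrightarrow> is_alg sig B \<Longrightarrow>
    isomorphic sig (direct_product I A) B \<Longrightarrow> B \<in> K"
  unfolding pseudovariety_def by blast

lemma pseudovariety_nonempty:
  assumes "pseudovariety sig K"
  obtains A where "A \<in> K"
proof -
  define B :: "('a, nat) alg" where "B = \<lparr>carr = {0}, oper = \<lambda>_ _. 0\<rparr>"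
  have "is_alg sig B" by (simp add: B_def is_alg_def closed_under_ops_def)
  moreover have "isomorphic sig (direct_product {} (\<lambda>_::nat. B)) B"
    by (auto simp: isomorphic_def hom_alg_def B_def direct_product_def bij_betw_def
        intro!: bexI[of _ "\<lambda>_. 0"])
  ultimately have "B \<in> K"
    using pseudovariety_direct_product[OF assms, of "{}" "\<lambda>_. B" B] by simp
  then show thesis using that by blast
qed

text \<open>The values at \<open>e\<close> form the free algebra of the class on \<open>V\<close>.
  Pairing \<open>e\<close> with another valuation can only split values; by maximality it splits
  none, so each value at \<open>e\<close> determines the value in the other algebra.\<close>

lemma free_valuation:
  fixes K :: "('f, nat) alg set"
  assumes K: "pseudovariety sig K" "uniformly_locally_finite sig K" and V: "finite V"
  obtains P e where "P \<in> K" "range e \<subseteq> carr P"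
    and "\<And>A (d :: nat \<Rightarrow> nat) s t. \<lbrakk>A \<in> K; range d \<subseteq> carr A; s \<in> terms_over sig V; t \<in> terms_over sig V;
           trm_val P e s = trm_val P e t\<rbrakk> \<Longrightarrow> trm_val A d s = trm_val A d t"
proof -
  have alg: "is_alg sig A" "finite (carr A)" if "A \<in> K" for A
    using pseudovariety_alg[OF K(1) that] by simp_all
  obtain m where m: "\<And>A X. \<lbrakk>A \<in> K; X \<subseteq> carr A; finite X; card X \<le> card V\<rbrakk> \<Longrightarrow>
      finite (generated sig A X) \<and> card (generated sig A X) \<le> m"
    using K(2) unfolding uniformly_locally_finite_def by metis
  define Q where "Q = (\<lambda>(A, e :: nat \<Rightarrow> nat). A \<in> K \<and> range e \<subseteq> carr A)"
  define size where "size = (\<lambda>(A :: ('f, nat) alg, e). card (term_values sig V A e))"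
  \<comment> \<open>\<open>ex_has_greatest_nat\<close> asks for a strict bound, hence
    \<open>Suc m\<close>.\<close>
  have "size z < Suc m" if Qz: "Q z" for z
  proof -
    obtain A e where z: "z = (A, e)" by (cases z)
    have A: "A \<in> K" "range e \<subseteq> carr A" using Qz by (auto simp: z Q_def)
    have "finite (generated sig A (e ` V)) \<and> card (generated sig A (e ` V)) \<le> m"
      using A V by (intro m) (auto simp: card_image_le)
    then have "card (term_values sig V A e) \<le> m"
      using card_mono[OF _ term_values_subset_generated] le_trans by blast
    then show ?thesis by (simp add: size_def z)
  qed
  moreover obtain A0 where A0: "A0 \<in> K" using pseudovariety_nonempty[OF K(1)] .
  moreover obtain a0 where "a0 \<in> carr A0" using alg[OF A0] by (auto simp: is_alg_def)
  ultimately have "Q (A0, \<lambda>_. a0)" and bound: "\<forall>z. Q z \<longrightarrow> size z < Suc m"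
    by (auto simp: Q_def)
  then obtain z where z: "Q z" "\<And>y. Q y \<Longrightarrow> size y \<le> size z"
    using ex_has_greatest_nat[OF _ bound] by blast
  obtain P e where Pe: "z = (P, e)" by (cases z)
  have P: "P \<in> K" "range e \<subseteq> carr P" using z(1) by (auto simp: Pe Q_def)
  show thesis
  proof (rule that[OF P])
    fix A :: "('f, nat) alg" and d :: "nat \<Rightarrow> nat" and s t
    assume A: "A \<in> K" "range d \<subseteq> carr A"
      and st: "s \<in> terms_over sig V" "t \<in> terms_over sig V" "trm_val P e s = trm_val P e t"
    \<comment> \<open>Coordinate 0 carries \<open>P\<close> with \<open>e\<close>, coordinate 1
      carries \<open>A\<close> with \<open>d\<close>; \<open>c\<close> is the paired valuation in
      the product.\<close>
    define I where "I = {0, 1::nat}"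
    define C where "C = (\<lambda>i::nat. if i = 0 then P else A)"
    define D where "D = direct_product I C"
    define c where "c = (\<lambda>x. \<lambda>i\<in>I. (if i = 0 then e else d) x)"
    have CK: "\<forall>i\<in>I. C i \<in> K" using A P by (simp add: C_def)
    have D: "is_alg sig D"
      using CK alg unfolding D_def by (intro is_alg_direct_product) auto
    have "finite (carr D)"
      using CK alg by (auto simp: D_def direct_product_def I_def intro!: finite_PiE)
    \<comment> \<open>Elements of \<open>D\<close> are functions, whereas members of
      \<open>K\<close> have carriers of natural numbers. Maximality is therefore applied to a copy
      \<open>B\<close> and transported back along \<open>h\<close>.\<close>
    then obtain B :: "('f, nat) alg" where B: "is_alg sig B" "finite (carr B)" "isomorphic sig D B"
      using isomorphic_nat_copy[OF D] by blast
    have BK: "B \<in> K"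
      using pseudovariety_direct_product[OF K(1), of I C B] CK B(1,3) by (simp add: I_def D_def)
    obtain h where h: "h \<in> hom_alg sig D B" "bij_betw h (carr D) (carr B)"
      using B(3) by (auto simp: isomorphic_def)
    have c: "range c \<subseteq> carr D"
      using A(2) P(2) by (auto simp: c_def D_def direct_product_def C_def image_subset_iff)
    have val: "trm_val D c u = (\<lambda>i\<in>I. trm_val (C i) (if i = 0 then e else d) u)"
      if "u \<in> terms_over sig V" for u
      using that unfolding D_def
      by (intro trm_val_direct_product) (auto simp: c_def terms_over_def)
    have sub: "term_values sig V D c \<subseteq> carr D" by (rule term_values_subset_carr[OF D c])
    have fin: "finite (term_values sig V D c)"
      using sub \<open>finite (carr D)\<close> finite_subset by blast
    have "range (h \<circ> c) \<subseteq> carr B" using c h(2) by (auto simp: bij_betw_def)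
    then have "size (B, h \<circ> c) \<le> size (P, e)" using z BK by (simp add: Pe Q_def)
    moreover have "card (term_values sig V B (h \<circ> c)) = card (term_values sig V D c)"
      unfolding term_values_hom[OF D h(1) c]
      by (rule card_image) (use sub h(2) in \<open>auto simp: bij_betw_def intro: inj_on_subset\<close>)
    \<comment> \<open>Projection to coordinate 0 maps the values in \<open>D\<close> onto those in
      \<open>P\<close>. Maximality gives the reverse inequality of cardinalities, so on these finite
      sets the projection is injective.\<close>
    moreover have proj: "term_values sig V P e = (\<lambda>u. u 0) ` term_values sig V D c"
      by (force simp: term_values_def image_image val I_def C_def)
    ultimately have "card ((\<lambda>u. u 0) ` term_values sig V D c) = card (term_values sig V D c)"
      using card_image_le[OF fin, of "\<lambda>u. u 0"] by (simp add: size_def)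
    then have inj: "inj_on (\<lambda>u. u 0) (term_values sig V D c)"
      by (rule eq_card_imp_inj_on[OF fin])
    \<comment> \<open>The two values agree at coordinate 0, hence are equal; coordinate 1 is then
      the claim about \<open>A\<close>.\<close>
    have "trm_val D c s = trm_val D c t"
      by (rule inj_onD[OF inj]) (use st in \<open>auto simp: term_values_def val I_def C_def\<close>)
    then have "trm_val D c s 1 = trm_val D c t 1" by simp
    then show "trm_val A d s = trm_val A d t"
      using st by (simp add: val I_def C_def)
  qed
qed

section \<open>Finite signatures\<close>

text \<open>The equations present the free algebra on \<open>V\<close>. The last clause does not put
  \<open>A\<close> itself into the class: it places each valuation of \<open>V\<close> inside a
  subalgebra from the class, which is what a sentence with universal variables in \<open>V\<close>
  requires.\<close>

lemma finite_basis:
  fixes K :: "('f, nat) alg set"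
  assumes K: "pseudovariety sig K" "uniformly_locally_finite sig K"
    and V: "finite V" "V \<noteq> {}" and sig: "finite (dom sig)"
  obtains es where "\<forall>p\<in>set es. universal_equation sig p"
    and "\<And>A p. \<lbrakk>A \<in> K; p \<in> set es\<rbrakk> \<Longrightarrow> models A p"
    and "\<And>A (d :: nat \<Rightarrow> nat). \<lbrakk>is_alg sig A; \<forall>p\<in>set es. models A p; range d \<subseteq> carr A\<rbrakk> \<Longrightarrow>
           \<exists>S\<subseteq>carr A. d ` V \<subseteq> S \<and> A\<lparr>carr := S\<rparr> \<in> K"
proof -
  have alg: "is_alg sig A" "finite (carr A)" if "A \<in> K" for A
    using pseudovariety_alg[OF K(1) that] by simp_all
  obtain P e where P: "P \<in> K" "range e \<subseteq> carr P"
    and free: "\<And>A (d :: nat \<Rightarrow> nat) s t. \<lbrakk>A \<in> K; range d \<subseteq> carr A; s \<in> terms_over sig V; t \<in> terms_over sig V;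
       trm_val P e s = trm_val P e t\<rbrakk> \<Longrightarrow> trm_val A d s = trm_val A d t"
    by (rule free_valuation[OF K V(1)]) (rule that)
  define G where "G = term_values sig V P e"
  have GP: "G \<subseteq> carr P"
    unfolding G_def using P alg by (intro term_values_subset_carr) auto
  have G_fin: "finite G" using GP alg(2)[OF P(1)] finite_subset by blast
  have eG: "e x \<in> G" if "x \<in> V" for x
    using that by (auto simp: G_def term_values_def terms_over_def intro!: image_eqI[of _ _ "Var x"])
  have G_closed: "closed_under_ops sig P G"
    unfolding G_def by (rule term_values_closed)
  have "\<forall>g\<in>G. \<exists>t. t \<in> terms_over sig V \<and> trm_val P e t = g"
    by (auto simp: G_def term_values_def)
  then obtain r where r: "\<And>g. g \<in> G \<Longrightarrow> r g \<in> terms_over sig V" "\<And>g. g \<in> G \<Longrightarrow> trm_val P e (r g) = g"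
    by metis
  \<comment> \<open>\<open>T\<close> indexes the entries of the operation tables of
    \<open>G\<close>. The equations \<open>E\<close> identify each variable with the representative
    of its value, and each operation applied to representatives with the representative of the
    result.\<close>
  define T where "T = Sigma (dom sig) (\<lambda>f. {gs. set gs \<subseteq> G \<and> length gs = the (sig f)})"
  define E where "E = (\<lambda>x. (Var x, r (e x))) ` V \<union>
    (\<lambda>(f, gs). (Fun f (map r gs), r (oper P f gs))) ` T"
  have "finite T"
    unfolding T_def using sig G_fin by (intro finite_SigmaI finite_lists_length_eq)
  then have "finite E" using V(1) by (simp add: E_def)
  then obtain El where El: "set El = E" using finite_list by blast
  have E: "s \<in> terms_over sig V \<and> t \<in> terms_over sig V \<and> trm_val P e s = trm_val P e t"
    if st: "(s, t) \<in> E" for s t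
  proof -
    from st consider (var) x where "x \<in> V" "s = Var x" "t = r (e x)"
      | (app) f gs where "(f, gs) \<in> T" "s = Fun f (map r gs)" "t = r (oper P f gs)"
      by (auto simp: E_def)
    then show ?thesis
    proof cases
      case var
      then show ?thesis using r eG by (auto simp: terms_over_def)
    next
      case app
      then have f: "sig f = Some (length gs)" "set gs \<subseteq> G" by (auto simp: T_def)
      then have "oper P f gs \<in> G" using G_closed by (simp add: closed_under_ops_def)
      moreover have "map (trm_val P e \<circ> r) gs = gs"
        by (rule map_idI) (use f r in auto)
      moreover have "Fun f (map r gs) \<in> terms_over sig V"
        using f r by (auto simp: Fun_in_terms_over)
      ultimately show ?thesis using r app by simp
    qed
  qed
  \<comment> \<open>All terms in \<open>E\<close> have their variables in \<open>V\<close>, so one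
    prefix closes every equation.\<close>
  obtain vs where vs: "set vs = V" using V(1) finite_list by blast
  define es where "es = map (\<lambda>(s, t). foldr All vs (Eq s t)) El"
  have es: "set es = (\<lambda>(s, t). foldr All vs (Eq s t)) ` E" by (simp add: es_def El)
  show thesis
  proof (rule that)
    show "\<forall>p\<in>set es. universal_equation sig p"
    proof
      fix p assume "p \<in> set es"
      then obtain s t where st: "(s, t) \<in> E" "p = foldr All vs (Eq s t)"
        by (auto simp: es)
      then show "universal_equation sig p"
        using E[OF st(1)] unfolding universal_equation_def sentence_def
        by (auto simp: wf_fm_foldr_All free_vars_foldr_All vs terms_over_def)
    qed
  next
    fix A p assume A: "A \<in> K" and p: "p \<in> set es"
    from p obtain s t where st: "(s, t) \<in> E" "p = foldr All vs (Eq s t)"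
      by (auto simp: es)
    show "models A p"
      unfolding st(2) models_foldr_All unfolding models_def using free[OF A] E[OF st(1)] by simp
  next
    fix A :: "('f, nat) alg" and d :: "nat \<Rightarrow> nat"
    assume A: "is_alg sig A" "\<forall>p\<in>set es. models A p" and d: "range d \<subseteq> carr A"
    have eq: "trm_val A d s = trm_val A d t" if "(s, t) \<in> E" for s t
    proof -
      have "models A (foldr All vs (Eq s t))" using A(2) that by (force simp: es)
      then show ?thesis using d unfolding models_foldr_All unfolding models_def by simp
    qed
    \<comment> \<open>The map sends a free generator \<open>e x\<close> to \<open>d x\<close> by the
      variable equations, and is a homomorphism on \<open>G\<close> by the table equations evaluated
      at \<open>d\<close>.\<close>
    define h where "h = (\<lambda>g. trm_val A d (r g))"
    have hcarr: "h ` G \<subseteq> carr A"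
      using r(1) trm_val_in_carr[OF A(1) d] by (auto simp: h_def terms_over_def)
    have dh: "d ` V \<subseteq> h ` G"
      using eq eG by (force simp: E_def h_def)
    have hom: "h (oper P f gs) = oper A f (map h gs)" "oper P f gs \<in> G"
      if "sig f = Some (length gs)" "set gs \<subseteq> G" for f gs
    proof -
      have "(f, gs) \<in> T" using that by (auto simp: T_def)
      then have "(Fun f (map r gs), r (oper P f gs)) \<in> E" by (force simp: E_def)
      then show "h (oper P f gs) = oper A f (map h gs)"
        using eq by (fastforce simp: h_def comp_def)
      show "oper P f gs \<in> G" using that G_closed by (simp add: closed_under_ops_def)
    qed
    define F where "F = P\<lparr>carr := G\<rparr>"
    \<comment> \<open>Carriers must be nonempty; a variable in \<open>V\<close> guarantees this even
      without constant symbols.\<close>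
    have "G \<noteq> {}" using eG V(2) by blast
    then have "subalgebra sig F P"
      using GP G_closed by (auto simp: subalgebra_def subuniverse_def F_def)
    moreover have "is_alg sig F"
      using G_closed \<open>G \<noteq> {}\<close> by (simp add: is_alg_def closed_under_ops_def F_def)
    ultimately have F: "F \<in> K"
      by (rule pseudovariety_subalgebra[OF K(1) P(1) _ _ isomorphic_refl])
    \<comment> \<open>The image keeps the operations of \<open>A\<close>; it lies in the class as a
      homomorphic image of the subalgebra \<open>F\<close> of \<open>P\<close>.\<close>
    define B where "B = A\<lparr>carr := h ` G\<rparr>"
    have "closed_under_ops sig B (carr B)"
      unfolding closed_under_ops_def
    proof (intro allI impI)
      fix f as assume *: "sig f = Some (length as) \<and> set as \<subseteq> carr B"
      then have "as \<in> lists (h ` G)" by (auto simp: B_def)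
      then obtain gs where gs: "as = map h gs" "set gs \<subseteq> G" by (auto simp: lists_image)
      then have "oper A f as = h (oper P f gs)" "oper P f gs \<in> G"
        using hom * by simp_all
      then show "oper B f as \<in> carr B" by (simp add: B_def)
    qed
    then have "is_alg sig B" using \<open>G \<noteq> {}\<close> by (simp add: is_alg_def B_def)
    moreover have "h \<in> hom_alg sig F B"
      using hom by (auto simp: hom_alg_def F_def B_def)
    then have "hom_image sig F B" by (auto simp: hom_image_def F_def B_def)
    ultimately have "B \<in> K" using pseudovariety_hom_image[OF K(1) F] by blast
    then show "\<exists>S\<subseteq>carr A. d ` V \<subseteq> S \<and> A\<lparr>carr := S\<rparr> \<in> K"
      using hcarr dh unfolding B_def by blast
  qed
qed

lemma finite_signature:
  fixes \<Phi> :: "'f fm"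
  assumes \<Phi>: "forall_exists_sentence sig \<Phi>"
    and K: "pseudovariety sig (Mod_fin sig \<Phi>)"
      "uniformly_locally_finite sig (Mod_fin sig \<Phi> :: ('f, nat) alg set)"
    and sig: "finite (dom sig)"
  shows "\<exists>es. (\<forall>p\<in>set es. universal_equation sig p) \<and>
           equivalent_on_finite sig \<Phi> (conjunction es)"
proof -
  let ?K = "Mod_fin sig \<Phi> :: ('f, nat) alg set"
  obtain xs ys q where q: "\<Phi> = foldr All xs (foldr Ex ys q)" "quantifier_free q"
    and "free_vars \<Phi> = {}"
    using \<Phi> by (auto simp: forall_exists_sentence_def sentence_def)
  then have fv: "free_vars (foldr Ex ys q) \<subseteq> set xs"
    by (simp add: free_vars_foldr_All)
  \<comment> \<open>Inserting 0 keeps \<open>V\<close> nonempty for an empty prefix and provides the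
    default element \<open>d 0\<close> below.\<close>
  define V where "V = insert 0 (set xs)"
  have V: "finite V" "V \<noteq> {}" by (auto simp: V_def)
  obtain es where es: "\<forall>p\<in>set es. universal_equation sig p"
    and sound: "\<And>A p. \<lbrakk>A \<in> ?K; p \<in> set es\<rbrakk> \<Longrightarrow> models A p"
    and ext: "\<And>A (d :: nat \<Rightarrow> nat). \<lbrakk>is_alg sig A; \<forall>p\<in>set es. models A p; range d \<subseteq> carr A\<rbrakk> \<Longrightarrow>
      \<exists>S\<subseteq>carr A. d ` V \<subseteq> S \<and> A\<lparr>carr := S\<rparr> \<in> ?K"
    by (rule finite_basis[OF K V sig]) (rule that)
  have complete: "models A \<Phi>" if A: "is_alg sig A" "\<forall>p\<in>set es. models A p" for A :: "('f, nat) alg"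
    unfolding q models_foldr_All unfolding models_def
  proof (intro allI impI)
    fix d :: "nat \<Rightarrow> nat" assume d: "range d \<subseteq> carr A"
    obtain S where S: "S \<subseteq> carr A" "d ` V \<subseteq> S" "A\<lparr>carr := S\<rparr> \<in> Mod_fin sig \<Phi>"
      using ext[OF A d] by blast
    \<comment> \<open>Outside \<open>V\<close> the valuation \<open>d\<close> may leave
      \<open>S\<close>. Redirecting those variables to \<open>d 0\<close> gives a valuation in
      \<open>S\<close> that agrees with \<open>d\<close> on the free variables of the existential
      part.\<close>
    define d' where "d' = (\<lambda>x. if x \<in> V then d x else d 0)"
    have "range d' \<subseteq> S" using S(2) by (auto simp: d'_def V_def)
    moreover have "models (A\<lparr>carr := S\<rparr>) (foldr Ex ys q)"
      using S(3) by (simp add: Mod_fin_def q models_foldr_All)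
    ultimately have "sat (A\<lparr>carr := S\<rparr>) d' (foldr Ex ys q)"
      by (simp add: models_def)
    then have "sat A d' (foldr Ex ys q)" by (rule sat_foldr_Ex_mono[OF q(2) S(1)])
    moreover have "sat A d' (foldr Ex ys q) \<longleftrightarrow> sat A d (foldr Ex ys q)"
      by (rule sat_cong) (use fv in \<open>auto simp: d'_def V_def\<close>)
    ultimately show "sat A d (foldr Ex ys q)" by simp
  qed
  have "A \<in> ?K \<longleftrightarrow> A \<in> Mod_fin sig (conjunction es)" for A
    using complete[of A] sound[of A] unfolding Mod_fin_def mem_Collect_eq models_conjunction by blast
  then have "equivalent_on_finite sig \<Phi> (conjunction es)"
    unfolding equivalent_on_finite_def by blast
  with es show ?thesis by blast
qed

section \<open>Reduction to the symbols of the sentence\<close>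

primrec syms_trm :: "'f trm \<Rightarrow> 'f set" where
  "syms_trm (Var x) = {}"
| "syms_trm (Fun f ts) = insert f (\<Union> (set (map syms_trm ts)))"

primrec syms_fm :: "'f fm \<Rightarrow> 'f set" where
  "syms_fm Bot = {}"
| "syms_fm (Eq s t) = syms_trm s \<union> syms_trm t"
| "syms_fm (Neg p) = syms_fm p"
| "syms_fm (And p q) = syms_fm p \<union> syms_fm q"
| "syms_fm (Or p q) = syms_fm p \<union> syms_fm q"
| "syms_fm (Imp p q) = syms_fm p \<union> syms_fm q"
| "syms_fm (All x p) = syms_fm p"
| "syms_fm (Ex x p) = syms_fm p"

lemma finite_syms_trm: "finite (syms_trm t)"
  by (induction t) auto

lemma finite_syms_fm: "finite (syms_fm p)"
  by (induction p) (auto simp: finite_syms_trm)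

lemma wf_trm_restrict: "wf_trm sig t \<Longrightarrow> syms_trm t \<subseteq> F \<Longrightarrow> wf_trm (sig |` F) t"
  by (induction t) (auto simp: list_all_iff restrict_map_def)

lemma wf_fm_restrict: "wf_fm sig p \<Longrightarrow> syms_fm p \<subseteq> F \<Longrightarrow> wf_fm (sig |` F) p"
  by (induction p) (auto simp: wf_trm_restrict)

lemma map_leD: "sig0 \<subseteq>\<^sub>m sig \<Longrightarrow> sig0 f = Some n \<Longrightarrow> sig f = Some n"
  by (metis domI map_le_def)

lemma wf_trm_map_le: "sig0 \<subseteq>\<^sub>m sig \<Longrightarrow> wf_trm sig0 t \<Longrightarrow> wf_trm sig t"
  by (induction t) (auto simp: list_all_iff dest: map_leD)

lemma wf_fm_map_le: "sig0 \<subseteq>\<^sub>m sig \<Longrightarrow> wf_fm sig0 p \<Longrightarrow> wf_fm sig p"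
  by (induction p) (auto simp: wf_trm_map_le)

lemma is_alg_map_le: "sig0 \<subseteq>\<^sub>m sig \<Longrightarrow> is_alg sig A \<Longrightarrow> is_alg sig0 A"
  unfolding is_alg_def closed_under_ops_def by (blast dest: map_leD)

section \<open>Expansions by constant operations\<close>

definition expand :: "'f signature \<Rightarrow> 'a \<Rightarrow> ('f, 'a) alg \<Rightarrow> ('f, 'a) alg" where
  "expand sig0 a A = A\<lparr>oper := \<lambda>f as. if f \<in> dom sig0 then oper A f as else a\<rparr>"

lemma carr_expand [simp]: "carr (expand sig0 a A) = carr A"
  by (simp add: expand_def)

lemma expand_carr_update: "expand sig0 a (A\<lparr>carr := S\<rparr>) = (expand sig0 a A)\<lparr>carr := S\<rparr>"
  by (rule alg.equality) (simp_all add: expand_def cong: if_cong)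

lemma oper_expand:
  "oper (expand sig0 a A) f as = (if f \<in> dom sig0 then oper A f as else a)"
  by (simp add: expand_def)

context
  fixes sig0 sig :: "'f signature"
  assumes le: "sig0 \<subseteq>\<^sub>m sig"
begin

lemma sig_eq: "f \<in> dom sig0 \<Longrightarrow> sig0 f = sig f"
  using le by (simp add: map_le_def)

lemma closed_under_ops_expand:
  assumes "a \<in> S"
  shows "closed_under_ops sig (expand sig0 a A) S \<longleftrightarrow> closed_under_ops sig0 A S"
proof -
  have "(sig f = Some (length as) \<and> set as \<subseteq> S \<longrightarrow> oper (expand sig0 a A) f as \<in> S) \<longleftrightarrow>
    (sig0 f = Some (length as) \<and> set as \<subseteq> S \<longrightarrow> oper A f as \<in> S)" for f as
    using assms by (cases "f \<in> dom sig0") (simp_all add: oper_expand sig_eq domIff)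
  then show ?thesis by (simp add: closed_under_ops_def)
qed

text \<open>No membership of \<open>a\<close> in \<open>S\<close> is assumed, so this direction also
  serves for generating sets that omit \<open>a\<close>.\<close>

lemma closed_under_ops_of_expand:
  "closed_under_ops sig (expand sig0 a A) S \<Longrightarrow> closed_under_ops sig0 A S"
  unfolding closed_under_ops_def by (metis domI map_leD[OF le] oper_expand)

lemma is_alg_expand: "a \<in> carr A \<Longrightarrow> is_alg sig0 A \<Longrightarrow> is_alg sig (expand sig0 a A)"
  by (simp add: is_alg_def closed_under_ops_expand)

text \<open>The constant value in \<open>B\<close> must be \<open>h a\<close> for \<open>h\<close>
  to preserve the added operations.\<close>

lemma hom_alg_expand:
  "h \<in> hom_alg sig0 A B \<Longrightarrow> h \<in> hom_alg sig (expand sig0 a A) (expand sig0 (h a) B)"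
  by (auto simp: hom_alg_def oper_expand sig_eq)

text \<open>Over \<open>sig0\<close> the identity is an isomorphism from \<open>A\<close> to its
  expansion, and \<open>p\<close> is a formula over \<open>sig0\<close>.\<close>

lemma Mod_fin_expand:
  assumes "a \<in> carr A" "wf_fm sig0 p" "is_alg sig0 A"
  shows "expand sig0 a A \<in> Mod_fin sig p \<longleftrightarrow> A \<in> Mod_fin sig0 p"
proof -
  have iso: "isomorphic sig0 A (expand sig0 a A)"
    unfolding isomorphic_def by (rule bexI[of _ id]) (auto simp: hom_alg_def oper_expand)
  show ?thesis
    using models_iso[OF assms(3) iso assms(2)] is_alg_expand[OF assms(1,3)] assms by (simp add: Mod_fin_def)
qed

text \<open>For each closure condition, the given algebras are expanded with compatible constants,
  the condition is applied over \<open>sig\<close>, and the result is read again over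
  \<open>sig0\<close>.\<close>

lemma pseudovariety_reduct:
  assumes p: "wf_fm sig0 p" and K: "pseudovariety sig (Mod_fin sig p)"
  shows "pseudovariety sig0 (Mod_fin sig0 p)"
  unfolding pseudovariety_def
proof (intro conjI ballI allI impI)
  fix A :: "('f, nat) alg" assume "A \<in> Mod_fin sig0 p"
  then show "is_alg sig0 A" "finite (carr A)" by (auto simp: Mod_fin_def)
next
  fix A B :: "('f, nat) alg"
  assume A: "A \<in> Mod_fin sig0 p" and "is_alg sig0 B \<and> hom_image sig0 A B"
  then obtain h where B: "is_alg sig0 B" and h: "h \<in> hom_alg sig0 A B" "h ` carr A = carr B"
    by (auto simp: hom_image_def)
  have A': "is_alg sig0 A" using A by (simp add: Mod_fin_def)
  then obtain a where a: "a \<in> carr A" by (auto simp: is_alg_def)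
  have ha: "h a \<in> carr B" using a h by blast
  have "hom_image sig (expand sig0 a A) (expand sig0 (h a) B)"
    using hom_alg_expand[OF h(1)] h(2) by (auto simp: hom_image_def)
  moreover have "expand sig0 a A \<in> Mod_fin sig p" using Mod_fin_expand[OF a p A'] A by simp
  ultimately have "expand sig0 (h a) B \<in> Mod_fin sig p"
    using pseudovariety_hom_image[OF K _ is_alg_expand[OF ha B]] by blast
  then show "B \<in> Mod_fin sig0 p" using Mod_fin_expand[OF ha p B] by simp
next
  fix A S B :: "('f, nat) alg"
  assume A: "A \<in> Mod_fin sig0 p" and *: "subalgebra sig0 S A \<and> is_alg sig0 B \<and> isomorphic sig0 S B"
  then obtain h where B: "is_alg sig0 B" and h: "h \<in> hom_alg sig0 S B" "bij_betw h (carr S) (carr B)"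
    by (auto simp: isomorphic_def)
  obtain U where U: "U \<noteq> {}" "U \<subseteq> carr A" "closed_under_ops sig0 A U" "S = A\<lparr>carr := U\<rparr>"
    using * by (auto simp: subalgebra_def subuniverse_def)
  \<comment> \<open>The constant is taken inside \<open>U\<close>, so that \<open>U\<close> stays
    closed under the added operations.\<close>
  then obtain a where a: "a \<in> U" by blast
  have A': "is_alg sig0 A" using A by (simp add: Mod_fin_def)
  have ha: "h a \<in> carr B" using a h(2) by (auto simp: U(4) bij_betw_def)
  have "subalgebra sig (expand sig0 a S) (expand sig0 a A)"
    unfolding subalgebra_def subuniverse_def
    using U a by (intro exI[of _ U]) (simp add: closed_under_ops_expand expand_carr_update)
  moreover have "isomorphic sig (expand sig0 a S) (expand sig0 (h a) B)"
    using hom_alg_expand[OF h(1)] h(2) by (auto simp: isomorphic_def)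
  moreover have "expand sig0 a A \<in> Mod_fin sig p"
    using Mod_fin_expand[OF _ p A'] A a U(2) by blast
  ultimately have "expand sig0 (h a) B \<in> Mod_fin sig p"
    using pseudovariety_subalgebra[OF K _ _ is_alg_expand[OF ha B]] by blast
  then show "B \<in> Mod_fin sig0 p" using Mod_fin_expand[OF ha p B] by simp
next
  fix I :: "nat set" and A :: "nat \<Rightarrow> ('f, nat) alg" and B :: "('f, nat) alg"
  assume *: "finite I \<and> (\<forall>i\<in>I. A i \<in> Mod_fin sig0 p) \<and> is_alg sig0 B \<and>
    isomorphic sig0 (direct_product I A) B"
  then obtain h where B: "is_alg sig0 B"
    and h: "h \<in> hom_alg sig0 (direct_product I A) B" "bij_betw h (carr (direct_product I A)) (carr B)"
    by (auto simp: isomorphic_def)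
  have A: "is_alg sig0 (A i)" if "i \<in> I" for i
    using * that by (simp add: Mod_fin_def)
  then have "\<forall>i\<in>I. \<exists>a. a \<in> carr (A i)" by (auto simp: is_alg_def)
  then obtain a where a: "\<And>i. i \<in> I \<Longrightarrow> a i \<in> carr (A i)" by metis
  define A' where "A' = (\<lambda>i. expand sig0 (a i) (A i))"
  have A'K: "A' i \<in> Mod_fin sig p" if "i \<in> I" for i
    using Mod_fin_expand[OF a[OF that] p A[OF that]] * that by (simp add: A'_def)
  have ha: "h (restrict a I) \<in> carr B"
    using a h(2) by (auto simp: bij_betw_def direct_product_def)
  \<comment> \<open>Products are formed coordinatewise, so the tuple of the chosen constants is the
    constant of the product. It is restricted to \<open>I\<close> to be an extensional
    function.\<close>
  have "direct_product I A' = expand sig0 (restrict a I) (direct_product I A)"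
    by (auto simp: direct_product_def A'_def expand_def fun_eq_iff cong: restrict_cong)
  then have iso: "isomorphic sig (direct_product I A') (expand sig0 (h (restrict a I)) B)"
    using hom_alg_expand[OF h(1)] h(2) by (auto simp: isomorphic_def)
  have fin: "finite I" using * by blast
  have "expand sig0 (h (restrict a I)) B \<in> Mod_fin sig p"
    by (rule pseudovariety_direct_product[OF K fin _ is_alg_expand[OF ha B] iso]) (rule A'K)
  then show "B \<in> Mod_fin sig0 p" using Mod_fin_expand[OF ha p B] by simp
qed

lemma uniformly_locally_finite_reduct:
  assumes p: "wf_fm sig0 p"
    and K: "uniformly_locally_finite sig (Mod_fin sig p :: ('f, 'a) alg set)"
  shows "uniformly_locally_finite sig0 (Mod_fin sig0 p :: ('f, 'a) alg set)"
  unfolding uniformly_locally_finite_def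
proof
  fix n
  obtain m where m: "\<And>(A :: ('f, 'a) alg) X.
      \<lbrakk>A \<in> Mod_fin sig p; X \<subseteq> carr A; finite X; card X \<le> n\<rbrakk> \<Longrightarrow>
      finite (generated sig A X) \<and> card (generated sig A X) \<le> m"
    using K unfolding uniformly_locally_finite_def by metis
  have "finite (generated sig0 A X) \<and> card (generated sig0 A X) \<le> m"
    if A: "A \<in> Mod_fin sig0 p" and X: "X \<subseteq> carr A \<and> finite X \<and> card X \<le> n"
    for A :: "('f, 'a) alg" and X
  proof -
    have A': "is_alg sig0 A" using A by (simp add: Mod_fin_def)
    then obtain a where a: "a \<in> carr A" by (auto simp: is_alg_def)
    have "expand sig0 a A \<in> Mod_fin sig p" using Mod_fin_expand[OF a p A'] A by simp
    then have *: "finite (generated sig (expand sig0 a A) X)"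
      "card (generated sig (expand sig0 a A) X) \<le> m"
      using m X by simp_all
    \<comment> \<open>Subuniverses of the expansion are subuniverses of \<open>A\<close> over
      \<open>sig0\<close>, so over \<open>sig\<close> the intersection runs over fewer sets and the
      bound \<open>m\<close> carries over.\<close>
    have "generated sig0 A X \<subseteq> generated sig (expand sig0 a A) X"
      unfolding generated_def subuniverse_def
      by (rule Inter_anti_mono) (auto dest: closed_under_ops_of_expand)
    with * show ?thesis by (meson card_mono finite_subset le_trans)
  qed
  then show "\<exists>m. \<forall>A\<in>Mod_fin sig0 p :: ('f, 'a) alg set. \<forall>X. X \<subseteq> carr A \<and> finite X \<and> card X \<le> n \<longrightarrow>
      finite (generated sig0 A X) \<and> card (generated sig0 A X) \<le> m"
    by blast
qed

end

theorem corollary4p5: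
  fixes sig :: "'f signature" and \<Phi> :: "'f fm"
  assumes "forall_exists_sentence sig \<Phi>"
    and "pseudovariety sig (Mod_fin sig \<Phi>)"
    and "uniformly_locally_finite sig (Mod_fin sig \<Phi> :: ('f, nat) alg set)"
  shows "\<exists>es. (\<forall>p\<in>set es. universal_equation sig p) \<and>
           equivalent_on_finite sig \<Phi> (conjunction es)"
proof -
  \<comment> \<open>A sentence contains finitely many symbols, so \<open>sig0\<close> has a finite
    domain.\<close>
  define sig0 where "sig0 = sig |` syms_fm \<Phi>"
  have le: "sig0 \<subseteq>\<^sub>m sig" by (auto simp: sig0_def map_le_def)
  have wf: "wf_fm sig0 \<Phi>"
    using assms(1) unfolding sig0_def
    by (auto simp: forall_exists_sentence_def sentence_def intro: wf_fm_restrict)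
  have "forall_exists_sentence sig0 \<Phi>"
    using assms(1) wf by (simp add: forall_exists_sentence_def sentence_def)
  moreover have "finite (dom sig0)"
    by (simp add: sig0_def finite_syms_fm)
  ultimately obtain es where es: "\<forall>p\<in>set es. universal_equation sig0 p"
    and eq: "equivalent_on_finite sig0 \<Phi> (conjunction es)"
    using finite_signature[OF _ pseudovariety_reduct[OF le wf assms(2)]
        uniformly_locally_finite_reduct[OF le wf assms(3)]] by blast
  \<comment> \<open>The relation \<open>models\<close> does not mention the signature, and every
    algebra over \<open>sig\<close> is one over \<open>sig0\<close>; the equivalence over
    \<open>sig0\<close> therefore applies directly to \<open>A\<close>.\<close>
  have "models A \<Phi> \<longleftrightarrow> models A (conjunction es)"
    if "is_alg sig A" "finite (carr A)" for A :: "('f, nat) alg"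
    using eq is_alg_map_le[OF le that(1)] that(2)
    by (auto simp: equivalent_on_finite_def Mod_fin_def set_eq_iff)
  then have "equivalent_on_finite sig \<Phi> (conjunction es)"
    by (auto simp: equivalent_on_finite_def Mod_fin_def)
  moreover have "\<forall>p\<in>set es. universal_equation sig p"
    using es wf_fm_map_le[OF le] by (auto simp: universal_equation_def sentence_def)
  ultimately show ?thesis by blast
qed

end
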